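(* For incidence hypergraphs $G,H$, define $H^G$ by $\check V(H^G)=\mathbf{Set}(\check V(G),\check V(H))$, $\check E(H^G)=\mathbf{Set}(\check E(G),\check E(H))$, $I(H^G)=\mathfrak{R}(G,H)$, $\varsigma_{H^G}(\phi)=\check V(\phi)$, $\omega_{H^G}(\phi)=\check E(\phi)$, and define $\epsilon^G_H:G\times H^G\to H$ by $\check V(\epsilon^G_H)(v,f)=f(v)$, $\check E(\epsilon^G_H)(e,g)=g(e)$, $I(\epsilon^G_H)(i,\phi)=I(\phi)(i)$. Then for every incidence hypergraph $K$ and every morphism $\psi:G\times K\to H$ in $\mathfrak{R}$ there is a unique morphism $\hat\psi:K\to H^G$ such that $\epsilon^G_H\circ(G\times\hat\psi)=\psi$.
   Context: An incidence hypergraph $G$ consists of sets $\check V(G)$, $\check E(G)$, $I(G)$ and functions $\varsigma_G:I(G)\to\check V(G)$, $\omega_G:I(G)\to\check E(G)$; a morphism $\phi:G\to H$ is a triple of functions $(\check V(\phi),\check E(\phi),I(\phi))$ with $\varsigma_H\circ I(\phi)=\check V(\phi)\circ\varsigma_G$ and $\omega_H\circ I(\phi)=\check E(\phi)\circ\omega_G$; this is the category $\mathfrak{R}$, and $\mathfrak{R}(G,H)$ is its hom-set. The product $G\times K$ in $\mathfrak{R}$ is componentwise: vertices $\check V(G)\times\check V(K)$, edges $\check E(G)\times\check E(K)$, incidences $I(G)\times I(K)$, with $\varsigma_G\times\varsigma_K$ and $\omega_G\times\omega_K$. *)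

theory Defs
  imports Main "HOL-Library.FuncSet"
begin

record ('v, 'e, 'i) inc_hypergraph =
  verts :: "'v set"
  edges :: "'e set"
  incs :: "'i set"
  port :: "'i \<Rightarrow> 'v"
  att :: "'i \<Rightarrow> 'e"

definition is_inc_hypergraph :: "('v, 'e, 'i) inc_hypergraph \<Rightarrow> bool" where
  "is_inc_hypergraph G \<longleftrightarrow>
     port G \<in> incs G \<rightarrow> verts G \<and> att G \<in> incs G \<rightarrow> edges G"

record ('v, 'e, 'i, 'w, 'f, 'j) ih_morphism =
  vmap :: "'v \<Rightarrow> 'w"
  emap :: "'e \<Rightarrow> 'f"
  imap :: "'i \<Rightarrow> 'j"

text \<open>
  The set of functions from A to B is rendered as the extensional function space
  \<open>A \<rightarrow>\<^sub>E B\<close>: functions take the value \<open>undefined\<close> outside A. Hence HOL equality of functions,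
  and of triples of functions, is equality of the set-theoretic maps.
\<close>

definition ih_hom ::
  "('v, 'e, 'i) inc_hypergraph \<Rightarrow> ('w, 'f, 'j) inc_hypergraph
     \<Rightarrow> ('v, 'e, 'i, 'w, 'f, 'j) ih_morphism set" where
  "ih_hom G H = {\<phi>.
     vmap \<phi> \<in> verts G \<rightarrow>\<^sub>E verts H \<and>
     emap \<phi> \<in> edges G \<rightarrow>\<^sub>E edges H \<and>
     imap \<phi> \<in> incs G \<rightarrow>\<^sub>E incs H \<and>
     (\<forall>i\<in>incs G. port H (imap \<phi> i) = vmap \<phi> (port G i)) \<and>
     (\<forall>i\<in>incs G. att H (imap \<phi> i) = emap \<phi> (att G i))}"

definition ih_id :: "('v, 'e, 'i) inc_hypergraph \<Rightarrow> ('v, 'e, 'i, 'v, 'e, 'i) ih_morphism" where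
  "ih_id G = \<lparr>vmap = (\<lambda>v\<in>verts G. v), emap = (\<lambda>e\<in>edges G. e), imap = (\<lambda>i\<in>incs G. i)\<rparr>"

text \<open>\<open>ih_comp G \<psi> \<phi>\<close> is the composite of \<open>\<phi>\<close> (with domain G) followed by \<open>\<psi>\<close>.\<close>

definition ih_comp ::
  "('v, 'e, 'i) inc_hypergraph \<Rightarrow> ('w, 'f, 'j, 'x, 'g, 'k) ih_morphism
     \<Rightarrow> ('v, 'e, 'i, 'w, 'f, 'j) ih_morphism \<Rightarrow> ('v, 'e, 'i, 'x, 'g, 'k) ih_morphism" where
  "ih_comp G \<psi> \<phi> =
     \<lparr>vmap = compose (verts G) (vmap \<psi>) (vmap \<phi>),
      emap = compose (edges G) (emap \<psi>) (emap \<phi>),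
      imap = compose (incs G) (imap \<psi>) (imap \<phi>)\<rparr>"

definition ih_prod ::
  "('v, 'e, 'i) inc_hypergraph \<Rightarrow> ('w, 'f, 'j) inc_hypergraph
     \<Rightarrow> ('v \<times> 'w, 'e \<times> 'f, 'i \<times> 'j) inc_hypergraph" where
  "ih_prod G K =
     \<lparr>verts = verts G \<times> verts K, edges = edges G \<times> edges K, incs = incs G \<times> incs K,
      port = map_prod (port G) (port K), att = map_prod (att G) (att K)\<rparr>"

text \<open>
  \<open>ih_prod_map G K \<alpha> \<beta>\<close> is the product \<open>\<alpha> \<times> \<beta>\<close> of morphisms with domains G and K; the morphism
  written \<open>G \<times> \<beta>\<close> is \<open>ih_prod_map G K (ih_id G) \<beta>\<close>.
\<close>

definition ih_prod_map ::
  "('v, 'e, 'i) inc_hypergraph \<Rightarrow> ('w, 'f, 'j) inc_hypergraph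
     \<Rightarrow> ('v, 'e, 'i, 'v2, 'e2, 'i2) ih_morphism \<Rightarrow> ('w, 'f, 'j, 'w2, 'f2, 'j2) ih_morphism
     \<Rightarrow> ('v \<times> 'w, 'e \<times> 'f, 'i \<times> 'j, 'v2 \<times> 'w2, 'e2 \<times> 'f2, 'i2 \<times> 'j2) ih_morphism" where
  "ih_prod_map G K \<alpha> \<beta> =
     \<lparr>vmap = restrict (map_prod (vmap \<alpha>) (vmap \<beta>)) (verts G \<times> verts K),
      emap = restrict (map_prod (emap \<alpha>) (emap \<beta>)) (edges G \<times> edges K),
      imap = restrict (map_prod (imap \<alpha>) (imap \<beta>)) (incs G \<times> incs K)\<rparr>"

text \<open>\<open>ih_power H G\<close> is the exponential \<open>H\<^sup>G\<close>, and \<open>ih_eval G H\<close> its evaluation.\<close>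

definition ih_power ::
  "('w, 'f, 'j) inc_hypergraph \<Rightarrow> ('v, 'e, 'i) inc_hypergraph
     \<Rightarrow> ('v \<Rightarrow> 'w, 'e \<Rightarrow> 'f, ('v, 'e, 'i, 'w, 'f, 'j) ih_morphism) inc_hypergraph" where
  "ih_power H G =
     \<lparr>verts = verts G \<rightarrow>\<^sub>E verts H, edges = edges G \<rightarrow>\<^sub>E edges H, incs = ih_hom G H,
      port = vmap, att = emap\<rparr>"

definition ih_eval ::
  "('v, 'e, 'i) inc_hypergraph \<Rightarrow> ('w, 'f, 'j) inc_hypergraph
     \<Rightarrow> ('v \<times> ('v \<Rightarrow> 'w), 'e \<times> ('e \<Rightarrow> 'f), 'i \<times> ('v, 'e, 'i, 'w, 'f, 'j) ih_morphism, 'w, 'f, 'j)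
          ih_morphism" where
  "ih_eval G H =
     \<lparr>vmap = (\<lambda>(v, f) \<in> verts (ih_prod G (ih_power H G)). f v),
      emap = (\<lambda>(e, g) \<in> edges (ih_prod G (ih_power H G)). g e),
      imap = (\<lambda>(i, \<phi>) \<in> incs (ih_prod G (ih_power H G)). imap \<phi> i)\<rparr>"

lemma ih_id_hom: "is_inc_hypergraph G \<Longrightarrow> ih_id G \<in> ih_hom G G"
  by (auto simp: is_inc_hypergraph_def ih_hom_def ih_id_def Pi_iff)

lemma ih_comp_hom:
  assumes "is_inc_hypergraph G" "\<phi> \<in> ih_hom G H" "\<psi> \<in> ih_hom H L"
  shows "ih_comp G \<psi> \<phi> \<in> ih_hom G L"
  using assms
  by (auto simp: is_inc_hypergraph_def ih_hom_def ih_comp_def compose_def Pi_iff PiE_iff)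

lemma is_inc_hypergraph_prod:
  "is_inc_hypergraph G \<Longrightarrow> is_inc_hypergraph K \<Longrightarrow> is_inc_hypergraph (ih_prod G K)"
  by (auto simp: is_inc_hypergraph_def ih_prod_def Pi_iff)

lemma ih_prod_map_hom:
  assumes "is_inc_hypergraph G" "is_inc_hypergraph K"
    and "\<alpha> \<in> ih_hom G G'" "\<beta> \<in> ih_hom K K'"
  shows "ih_prod_map G K \<alpha> \<beta> \<in> ih_hom (ih_prod G K) (ih_prod G' K')"
  using assms
  by (auto simp: is_inc_hypergraph_def ih_hom_def ih_prod_def ih_prod_map_def Pi_iff PiE_iff)

end

theory Submission imports Defs begin

text \<open>
  The adjunct of \<open>\<psi>\<close> is obtained by currying each of its three components. Incidence preservation
  of \<open>\<psi>\<close> says exactly that, for each incidence \<open>k\<close> of \<open>K\<close>, the curried maps at \<open>port K k\<close>,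
  \<open>att K k\<close> and \<open>k\<close> form one morphism from \<open>G\<close> to \<open>H\<close>, i.e. an incidence of \<open>H\<^sup>G\<close>.
\<close>

definition ih_uncurry ::
  "('v, 'e, 'i) inc_hypergraph \<Rightarrow> ('x, 'g, 'k) inc_hypergraph
     \<Rightarrow> ('x, 'g, 'k, 'v \<Rightarrow> 'w, 'e \<Rightarrow> 'f, ('v, 'e, 'i, 'w, 'f, 'j) ih_morphism) ih_morphism
     \<Rightarrow> ('v \<times> 'x, 'e \<times> 'g, 'i \<times> 'k, 'w, 'f, 'j) ih_morphism" where
  "ih_uncurry G K \<beta> =
     \<lparr>vmap = (\<lambda>(v, x) \<in> verts G \<times> verts K. vmap \<beta> x v),
      emap = (\<lambda>(e, y) \<in> edges G \<times> edges K. emap \<beta> y e),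
      imap = (\<lambda>(i, k) \<in> incs G \<times> incs K. imap (imap \<beta> k) i)\<rparr>"

text \<open>The lambdas are restricted at both levels because \<open>\<rightarrow>\<^sub>E\<close>
  in \<open>ih_power\<close> requires the values of the adjunct, not only the adjunct itself, to be
  extensional.\<close>

definition ih_curry ::
  "('v, 'e, 'i) inc_hypergraph \<Rightarrow> ('x, 'g, 'k) inc_hypergraph
     \<Rightarrow> ('v \<times> 'x, 'e \<times> 'g, 'i \<times> 'k, 'w, 'f, 'j) ih_morphism
     \<Rightarrow> ('x, 'g, 'k, 'v \<Rightarrow> 'w, 'e \<Rightarrow> 'f, ('v, 'e, 'i, 'w, 'f, 'j) ih_morphism) ih_morphism" where
  "ih_curry G K \<psi> =
     \<lparr>vmap = (\<lambda>x\<in>verts K. \<lambda>v\<in>verts G. vmap \<psi> (v, x)),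
      emap = (\<lambda>y\<in>edges K. \<lambda>e\<in>edges G. emap \<psi> (e, y)),
      imap = (\<lambda>k\<in>incs K.
        \<lparr>vmap = (\<lambda>v\<in>verts G. vmap \<psi> (v, port K k)),
         emap = (\<lambda>e\<in>edges G. emap \<psi> (e, att K k)),
         imap = (\<lambda>i\<in>incs G. imap \<psi> (i, k))\<rparr>)\<rparr>"

lemma is_inc_hypergraph_power: "is_inc_hypergraph (ih_power H G)"
  by (auto simp: is_inc_hypergraph_def ih_power_def ih_hom_def)

text \<open>An incidence of the power is a morphism \<open>\<phi>\<close> with
  \<open>vmap \<phi>\<close> as port and \<open>emap \<phi>\<close> as attachment, so preservation
  by evaluation is the morphism law of \<open>\<phi>\<close> itself.\<close>

lemma ih_eval_hom:
  assumes "is_inc_hypergraph G"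
  shows "ih_eval G H \<in> ih_hom (ih_prod G (ih_power H G)) H"
  using assms
  by (auto simp: is_inc_hypergraph_def ih_hom_def ih_prod_def ih_power_def ih_eval_def
      Pi_iff PiE_iff)

text \<open>This turns the universal property into bijectivity of currying: the triangle for
  \<open>\<beta>\<close> commutes with \<open>\<psi>\<close> iff
  \<open>ih_uncurry G K \<beta> = \<psi>\<close>.\<close>

lemma ih_eval_comp_prod_map:
  assumes "\<beta> \<in> ih_hom K (ih_power H G)"
  shows "ih_comp (ih_prod G K) (ih_eval G H) (ih_prod_map G K (ih_id G) \<beta>) = ih_uncurry G K \<beta>"
proof -
  \<comment> \<open>\<open>ih_eval\<close> is \<open>undefined\<close> off its carrier, so the
    values of \<open>\<beta>\<close> must be known to lie in the power.\<close>
  have "vmap \<beta> x \<in> verts G \<rightarrow>\<^sub>E verts H" if "x \<in> verts K" for x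
    using assms that by (auto simp: ih_hom_def ih_power_def)
  moreover have "emap \<beta> y \<in> edges G \<rightarrow>\<^sub>E edges H" if "y \<in> edges K" for y
    using assms that by (auto simp: ih_hom_def ih_power_def)
  moreover have "imap \<beta> k \<in> ih_hom G H" if "k \<in> incs K" for k
    \<comment> \<open>Instantiating at \<open>K\<close> unfolds only the outer hom-set;
      \<open>ih_hom G H\<close>, the incidence set of the power, stays folded.\<close>
    using assms that unfolding ih_hom_def[of K] by (auto simp: ih_power_def)
  ultimately show ?thesis
    by (auto simp: ih_comp_def ih_uncurry_def ih_eval_def ih_prod_map_def ih_prod_def
        ih_power_def ih_id_def compose_def fun_eq_iff restrict_def)
qed

lemma ih_curry_hom:
  assumes "is_inc_hypergraph G" "is_inc_hypergraph K" "\<psi> \<in> ih_hom (ih_prod G K) H"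
  shows "ih_curry G K \<psi> \<in> ih_hom K (ih_power H G)"
proof -
  have \<psi>: "\<And>v x. v \<in> verts G \<Longrightarrow> x \<in> verts K \<Longrightarrow> vmap \<psi> (v, x) \<in> verts H"
    "\<And>e y. e \<in> edges G \<Longrightarrow> y \<in> edges K \<Longrightarrow> emap \<psi> (e, y) \<in> edges H"
    "\<And>i k. i \<in> incs G \<Longrightarrow> k \<in> incs K \<Longrightarrow> imap \<psi> (i, k) \<in> incs H"
    "\<And>i k. i \<in> incs G \<Longrightarrow> k \<in> incs K \<Longrightarrow>
      port H (imap \<psi> (i, k)) = vmap \<psi> (port G i, port K k)"
    "\<And>i k. i \<in> incs G \<Longrightarrow> k \<in> incs K \<Longrightarrow>
      att H (imap \<psi> (i, k)) = emap \<psi> (att G i, att K k)"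
    using assms(3) by (auto simp: ih_hom_def ih_prod_def)
  \<comment> \<open>Well-formedness of \<open>G\<close> and \<open>K\<close> puts all ports and
    attachments inside the carriers, where the restricted lambdas can be evaluated and \<psi> has
    values in \<open>H\<close>.\<close>
  have "imap (ih_curry G K \<psi>) k \<in> ih_hom G H" if "k \<in> incs K" for k
    using assms(1,2) \<psi> that
    by (auto simp: ih_curry_def ih_hom_def is_inc_hypergraph_def Pi_iff)
  then have "imap (ih_curry G K \<psi>) \<in> incs K \<rightarrow>\<^sub>E ih_hom G H"
    by (auto simp: ih_curry_def)
  then show ?thesis
    using assms(2) \<psi>
    unfolding ih_hom_def[of K] by (auto simp: ih_curry_def ih_power_def is_inc_hypergraph_def Pi_iff)
qed

text \<open>Existence: the two sides agree pointwise on the product, and off it both are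
  \<open>undefined\<close>.\<close>

lemma ih_uncurry_curry:
  assumes "\<psi> \<in> ih_hom (ih_prod G K) H"
  shows "ih_uncurry G K (ih_curry G K \<psi>) = \<psi>"
  using assms
  by (intro ih_morphism.equality)
    (auto simp: ih_uncurry_def ih_curry_def ih_hom_def ih_prod_def PiE_iff extensional_def
      restrict_def fun_eq_iff)

text \<open>Uniqueness: uncurrying keeps only the incidence map of each
  \<open>imap \<beta> k\<close>. Its vertex and edge maps are recovered because
  \<open>\<beta>\<close> preserves incidence, which forces them to be
  \<open>vmap \<beta> (port K k)\<close> and \<open>emap \<beta> (att K k)\<close>.\<close>

lemma ih_curry_uncurry:
  assumes "is_inc_hypergraph K" "\<beta> \<in> ih_hom K (ih_power H G)"
  shows "ih_curry G K (ih_uncurry G K \<beta>) = \<beta>"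
proof -
  have v: "vmap \<beta> \<in> verts K \<rightarrow>\<^sub>E (verts G \<rightarrow>\<^sub>E verts H)"
    and e: "emap \<beta> \<in> edges K \<rightarrow>\<^sub>E (edges G \<rightarrow>\<^sub>E edges H)"
    and i: "imap \<beta> \<in> incs K \<rightarrow>\<^sub>E ih_hom G H"
    and pa: "\<And>k. k \<in> incs K \<Longrightarrow> vmap (imap \<beta> k) = vmap \<beta> (port K k)"
      "\<And>k. k \<in> incs K \<Longrightarrow> emap (imap \<beta> k) = emap \<beta> (att K k)"
    using assms(2) unfolding ih_hom_def[of K] by (auto simp: ih_power_def)
  have K: "\<And>k. k \<in> incs K \<Longrightarrow> port K k \<in> verts K" "\<And>k. k \<in> incs K \<Longrightarrow> att K k \<in> edges K"
    using assms(1) by (auto simp: is_inc_hypergraph_def)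
  have "vmap (ih_curry G K (ih_uncurry G K \<beta>)) = vmap \<beta>"
    using v by (auto simp: ih_curry_def ih_uncurry_def PiE_iff extensional_def restrict_def fun_eq_iff)
  moreover have "emap (ih_curry G K (ih_uncurry G K \<beta>)) = emap \<beta>"
    using e by (auto simp: ih_curry_def ih_uncurry_def PiE_iff extensional_def restrict_def fun_eq_iff)
  moreover have "imap (ih_curry G K (ih_uncurry G K \<beta>)) = imap \<beta>"
  proof
    fix k
    show "imap (ih_curry G K (ih_uncurry G K \<beta>)) k = imap \<beta> k"
    proof (cases "k \<in> incs K")
      case True
      then have "imap \<beta> k \<in> ih_hom G H"
        using i by auto
      \<comment> \<open>The reversed equations rewrite towards the components of
        \<open>imap \<beta> k\<close>, whose extensionality comes from membership in
        \<open>ih_hom G H\<close>.\<close>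
      then show ?thesis
        using True K[OF True] pa[OF True, symmetric]
        by (intro ih_morphism.equality)
          (auto simp: ih_curry_def ih_uncurry_def ih_hom_def PiE_iff extensional_def
            restrict_def fun_eq_iff)
    next
      case False
      then show ?thesis
        using i by (auto simp: ih_curry_def PiE_iff extensional_def)
    qed
  qed
  ultimately show ?thesis
    by (intro ih_morphism.equality) auto
qed

theorem mainTheorem17:
  fixes G :: "('v, 'e, 'i) inc_hypergraph"
    and H :: "('w, 'f, 'j) inc_hypergraph"
  assumes "is_inc_hypergraph G" and "is_inc_hypergraph H"
  shows "is_inc_hypergraph (ih_power H G) \<and>
    ih_eval G H \<in> ih_hom (ih_prod G (ih_power H G)) H \<and>
    (\<forall>K :: ('x, 'g, 'k) inc_hypergraph. is_inc_hypergraph K \<longrightarrow>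
      (\<forall>\<psi> \<in> ih_hom (ih_prod G K) H.
        \<exists>!\<psi>'. \<psi>' \<in> ih_hom K (ih_power H G) \<and>
          ih_comp (ih_prod G K) (ih_eval G H) (ih_prod_map G K (ih_id G) \<psi>') = \<psi>))"
proof (intro conjI allI impI ballI)
  show "is_inc_hypergraph (ih_power H G)"
    by (rule is_inc_hypergraph_power)
  show "ih_eval G H \<in> ih_hom (ih_prod G (ih_power H G)) H"
    using assms(1) by (rule ih_eval_hom)
next
  fix K :: "('x, 'g, 'k) inc_hypergraph" and \<psi>
  assume K: "is_inc_hypergraph K" and \<psi>: "\<psi> \<in> ih_hom (ih_prod G K) H"
  show "\<exists>!\<psi>'. \<psi>' \<in> ih_hom K (ih_power H G) \<and>
      ih_comp (ih_prod G K) (ih_eval G H) (ih_prod_map G K (ih_id G) \<psi>') = \<psi>"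
  proof (rule ex1I[of _ "ih_curry G K \<psi>"])
    show "ih_curry G K \<psi> \<in> ih_hom K (ih_power H G) \<and>
        ih_comp (ih_prod G K) (ih_eval G H) (ih_prod_map G K (ih_id G) (ih_curry G K \<psi>)) = \<psi>"
      using ih_curry_hom[OF assms(1) K \<psi>] ih_uncurry_curry[OF \<psi>]
      by (simp add: ih_eval_comp_prod_map)
  next
    fix \<beta>
    assume "\<beta> \<in> ih_hom K (ih_power H G) \<and>
        ih_comp (ih_prod G K) (ih_eval G H) (ih_prod_map G K (ih_id G) \<beta>) = \<psi>"
    then show "\<beta> = ih_curry G K \<psi>"
      \<comment> \<open>The assumed triangle reads \<open>ih_uncurry G K \<beta> = \<psi>\<close>;
        applying \<open>ih_curry G K\<close> to both sides isolates \<open>\<beta>\<close>.\<close>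
      using ih_eval_comp_prod_map ih_curry_uncurry[OF K] by metis
  qed
qed

end
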